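(* Let $\Bbbk$ be a field, let $X$ be a finite alphabet, and let $w:\mathbb{Z}\to X$ be a bi-infinite sequence that is minimal and non-periodic. Let $\mathcal{A}_w$ be the $\Bbbk$-algebra generated by the matrices $D_x$ ($x\in X$), $T$ and $T^\top$. Then $\mathcal{A}_w$ is simple, and its growth $\gamma(n)$ (with respect to any finite generating set containing the unit) satisfies \[C^{-1}n\cdot p_w(C^{-1}n)\le\gamma(n)\le Cn\cdot p_w(Cn)\] for some $C>1$ and all $n\ge 1$.
   Context: The matrices are indexed by $\mathbb{Z}\times\mathbb{Z}$ with entries in $\Bbbk$. For $x\in X$, $D_x=(a_{i,j})_{i,j\in\mathbb{Z}}$ is the diagonal matrix with $a_{i,j}=1$ if $i=j$ and $w(i)=x$, and $a_{i,j}=0$ otherwise. $T=(t_{i,j})_{i,j\in\mathbb{Z}}$ is the shift matrix with $t_{i,j}=1$ if $i=j+1$ and $t_{i,j}=0$ otherwise; $T^\top$ is its transpose. The sequence $w$ is minimal if for every finite subword $(w(n),w(n+1),\ldots,w(n+k))$ there exists $R>0$ such that for any $i\in\mathbb{Z}$ there exists $j\in\mathbb{Z}$ with $|i-j|\le R$ and $(w(j),\ldots,w(j+k))=(w(n),\ldots,w(n+k))$. It is non-periodic if there is no $p\ne 0$ such that $w(n+p)=w(n)$ for all $n\in\mathbb{Z}$. The complexity function $p_w(n)$ is the number of different subwords $(w(i),w(i+1),\ldots,w(i+n-1))$ of length $n$ in $w$, with $p_w(0)=1$; for real $t\ge 0$, $p_w(t)$ means $p_w(\lfloor t\rfloor)$.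 If $V$ is the $\Bbbk$-linear span of a finite generating set containing the unit of an algebra $\mathcal{A}$, and $V^n$ is the linear span of all products $a_1\cdots a_n$ with $a_i\in V$, then the growth of $\mathcal{A}$ (with respect to this generating set) is $\gamma(n)=\dim V^n$. The constant $C$ may depend on the generating set. *)

theory Defs
  imports Complex_Main "HOL-Library.Function_Algebras" "HOL-Library.Groups_Big_Fun"
    "HOL-Algebra.Ideal"
begin

definition subword :: "(int \<Rightarrow> 'x) \<Rightarrow> int \<Rightarrow> nat \<Rightarrow> 'x list" where
  "subword w i n = map (\<lambda>m. w (i + int m)) [0..<n]"

definition minimal_word :: "(int \<Rightarrow> 'x) \<Rightarrow> bool" where
  "minimal_word w \<longleftrightarrow>
    (\<forall>(n::int) (k::nat). \<exists>R::int. R > 0 \<and>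
      (\<forall>i. \<exists>j. \<bar>i - j\<bar> \<le> R \<and> subword w j (Suc k) = subword w n (Suc k)))"

definition nonperiodic_word :: "(int \<Rightarrow> 'x) \<Rightarrow> bool" where
  "nonperiodic_word w \<longleftrightarrow> \<not> (\<exists>p::int. p \<noteq> 0 \<and> (\<forall>n. w (n + p) = w n))"

definition complexity :: "(int \<Rightarrow> 'x) \<Rightarrow> nat \<Rightarrow> nat" where
  "complexity w n = card (range (\<lambda>i. subword w i n))"

definition complexity_real :: "(int \<Rightarrow> 'x) \<Rightarrow> real \<Rightarrow> nat" where
  "complexity_real w t = complexity w (nat \<lfloor>t\<rfloor>)"

text \<open>Addition and zero are the pointwise ones of \<^theory>\<open>HOL-Library.Function_Algebras\<close>. The
  pointwise product and unit from that theory are not the matrix product and unit, which are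
  \<open>zmult\<close> and \<open>zone\<close> below.\<close>

type_synonym 'k zmat = "int \<Rightarrow> int \<Rightarrow> 'k"

definition zscale :: "'k::field \<Rightarrow> 'k zmat \<Rightarrow> 'k zmat" where
  "zscale c A = (\<lambda>i j. c * A i j)"

definition zone :: "'k::field zmat" where
  "zone = (\<lambda>i j. if i = j then 1 else 0)"

text \<open>An entry whose defining sum has infinitely many nonzero terms gets the value \<open>0\<close>. This never
  happens for matrices with finitely many nonzero entries in each row, in particular not in the
  algebras generated by the matrices below, which have finite bandwidth.\<close>

definition zmult :: "'k::field zmat \<Rightarrow> 'k zmat \<Rightarrow> 'k zmat" where
  "zmult A B = (\<lambda>i j. Sum_any (\<lambda>l. A i l * B l j))"

definition D_mat :: "(int \<Rightarrow> 'x) \<Rightarrow> 'x \<Rightarrow> 'k::field zmat" where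
  "D_mat w x = (\<lambda>i j. if i = j \<and> w i = x then 1 else 0)"

definition T_mat :: "'k::field zmat" where
  "T_mat = (\<lambda>i j. if i = j + 1 then 1 else 0)"

definition ztranspose :: "'k zmat \<Rightarrow> 'k zmat" where
  "ztranspose A = (\<lambda>i j. A j i)"

global_interpretation zmat: vector_space "zscale :: 'k::field \<Rightarrow> 'k zmat \<Rightarrow> 'k zmat"
  by unfold_locales (auto simp: zscale_def fun_eq_iff algebra_simps)

inductive_set generated_algebra :: "'k::field zmat set \<Rightarrow> 'k zmat set"
  for G :: "'k zmat set" where
  gen: "A \<in> G \<Longrightarrow> A \<in> generated_algebra G"
| one: "zone \<in> generated_algebra G"
| scale: "A \<in> generated_algebra G \<Longrightarrow> zscale c A \<in> generated_algebra G"
| add: "A \<in> generated_algebra G \<Longrightarrow> B \<in> generated_algebra G \<Longrightarrow> A + B \<in> generated_algebra G"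
| mult: "A \<in> generated_algebra G \<Longrightarrow> B \<in> generated_algebra G \<Longrightarrow> zmult A B \<in> generated_algebra G"

definition word_algebra :: "'x set \<Rightarrow> (int \<Rightarrow> 'x) \<Rightarrow> 'k::field zmat set" where
  "word_algebra X w = generated_algebra (D_mat w ` X \<union> {T_mat, ztranspose T_mat})"

definition product_span :: "'k::field zmat set \<Rightarrow> nat \<Rightarrow> 'k zmat set" where
  "product_span V n = zmat.span {foldr zmult as zone | as. length as = n \<and> set as \<subseteq> V}"

definition growth :: "'k::field zmat set \<Rightarrow> nat \<Rightarrow> nat" where
  "growth S n = zmat.dim (product_span (zmat.span S) n)"

definition zmat_ring :: "'k::field zmat set \<Rightarrow> 'k zmat ring" where
  "zmat_ring A = \<lparr>carrier = A, mult = zmult, one = zone, zero = 0, add = (+)\<rparr>"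

text \<open>The algebras considered here are unital, so every ring ideal is closed under multiplication
  by scalars and the ring ideals are exactly the algebra ideals.\<close>

definition simple_ring :: "('a, 'b) ring_scheme \<Rightarrow> bool" where
  "simple_ring R \<longleftrightarrow> ring R \<and> carrier R \<noteq> {\<zero>\<^bsub>R\<^esub>} \<and>
    (\<forall>I. ideal I R \<longrightarrow> I = {\<zero>\<^bsub>R\<^esub>} \<or> I = carrier R)"

end

theory Submission
  imports Defs
begin

text \<open>
  Call a matrix \<open>r\<close>-local if it has bandwidth \<open>r\<close> and its entry at \<open>(i, i + d)\<close> depends only on
  \<open>d\<close> and on the window of \<open>w\<close> of radius \<open>r\<close> around \<open>i\<close>. A product of an \<open>r\<close>-local and an
  \<open>s\<close>-local matrix is \<open>(r + s)\<close>-local, and the generators of the algebra are local, so the whole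
  algebra is the union of its subspaces of local matrices. Both halves of the theorem rest on this.

  Growth, from above: if the finite generating set with span \<open>V\<close> is \<open>r\<close>-local, then \<open>V\<^sup>n\<close> is
  \<open>rn\<close>-local. A \<open>k\<close>-local matrix is a choice of one scalar for each of the \<open>2k + 1\<close> diagonals and each
  of the \<open>p\<^sub>w(2k + 1)\<close> windows, so the dimension is at most \<open>(2k + 1) p\<^sub>w(2k + 1)\<close> with \<open>k = rn\<close>
  (\<open>product_span_local\<close>, \<open>dim_le_if_local\<close>).

  Growth, from below: the matrices \<open>D\<^sub>x\<close>, \<open>T\<close> and its transpose \<open>T'\<close> lie in some \<open>V\<^sup>m\<close>. For a subword
  \<open>u = u\<^sub>1 \<dots> u\<^sub>k\<close>, the product of the \<open>D_mat w u\<^sub>i T'\<close> in order has entry 1 at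
  \<open>(i, i + k)\<close> exactly where \<open>u\<close> occurs at \<open>i\<close>; multiplying by a power of \<open>T\<close> moves it to any of
  \<open>k\<close> diagonals. This gives \<open>k p\<^sub>w(k)\<close> matrices with disjoint nonempty supports inside
  \<open>V\<close> to the power \<open>3mk\<close> (\<open>cell_in_product_span\<close>, \<open>cells_independent\<close>).

  Simplicity: a nonzero ideal contains, after a shift, a matrix \<open>N\<close> with a nonzero diagonal entry
  \<open>c\<close> at some \<open>i\<^sub>0\<close>. Let \<open>E\<close> be the diagonal idempotent of the positions whose large window equals
  the one at \<open>i\<^sub>0\<close>. As \<open>w\<close> is minimal and has no period, two such positions are never at a small
  nonzero distance (\<open>minimal_nonperiodic_uniform_separation\<close>); hence \<open>E N E\<close> is diagonal and, by
  locality, equals \<open>c E\<close>. So \<open>E\<close> is in the ideal, and with it all its conjugates by shifts. By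
  minimality finitely many of these cover the integers, and an ideal containing the idempotents of
  two sets of positions contains that of their union, so it contains the unit
  (\<open>word_algebra_ideal_trivial\<close>).
\<close>

section \<open>Row-finite matrices\<close>

text \<open>Row-finite matrices form the setting in which \<open>zmult\<close> is an honest associative and bilinear
  product: every sum that occurs is finite, so the default value of \<open>zmult\<close> is never taken.\<close>

definition row_finite :: "'k::field zmat \<Rightarrow> bool" where
  "row_finite A \<longleftrightarrow> (\<forall>i. finite {l. A i l \<noteq> 0})"

lemma zmult_eq_sum:
  assumes "finite F" "\<And>l. l \<notin> F \<Longrightarrow> A i l * B l j = 0"
  shows "zmult A B i j = (\<Sum>l\<in>F. A i l * B l j)"
  unfolding zmult_def using assms by (intro Sum_any.expand_superset) auto

lemma zmult_row_finite:
  assumes "row_finite A"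
  shows "zmult A B i j = (\<Sum>l | A i l \<noteq> 0. A i l * B l j)"
  by (rule zmult_eq_sum) (use assms in \<open>auto simp: row_finite_def\<close>)

lemma row_finite_subset:
  assumes "row_finite A" "\<And>i j. A i j = 0 \<Longrightarrow> B i j = 0"
  shows "row_finite B"
  unfolding row_finite_def
proof
  fix i
  have "{l. B i l \<noteq> 0} \<subseteq> {l. A i l \<noteq> 0}" using assms(2) by auto
  then show "finite {l. B i l \<noteq> 0}"
    using assms(1) unfolding row_finite_def by (meson finite_subset)
qed

lemma row_finite_zmult:
  assumes "row_finite A" "row_finite B"
  shows "row_finite (zmult A B)"
  unfolding row_finite_def
proof
  fix i
  have "{l. zmult A B i l \<noteq> 0} \<subseteq> (\<Union>k\<in>{k. A i k \<noteq> 0}. {l. B k l \<noteq> 0})"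
  proof
    fix l assume "l \<in> {l. zmult A B i l \<noteq> 0}"
    then have "(\<Sum>k | A i k \<noteq> 0. A i k * B k l) \<noteq> 0"
      by (simp add: zmult_row_finite[OF assms(1)])
    then obtain k where "A i k \<noteq> 0" "A i k * B k l \<noteq> 0"
      by (metis (mono_tags, lifting) mem_Collect_eq sum.neutral)
    then show "l \<in> (\<Union>k\<in>{k. A i k \<noteq> 0}. {l. B k l \<noteq> 0})" by auto
  qed
  moreover have "finite (\<Union>k\<in>{k. A i k \<noteq> 0}. {l. B k l \<noteq> 0})"
    using assms by (auto simp: row_finite_def)
  ultimately show "finite {l. zmult A B i l \<noteq> 0}" by (rule finite_subset)
qed

lemma subspace_row_finite: "zmat.subspace {A :: 'k::field zmat. row_finite A}"
proof -
  have "row_finite (A + B)" if "row_finite A" "row_finite B" for A B :: "'k zmat"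
    unfolding row_finite_def
  proof
    fix i
    have "{l. (A + B) i l \<noteq> 0} \<subseteq> {l. A i l \<noteq> 0} \<union> {l. B i l \<noteq> 0}" by auto
    moreover have "finite ({l. A i l \<noteq> 0} \<union> {l. B i l \<noteq> 0})"
      using that by (auto simp: row_finite_def)
    ultimately show "finite {l. (A + B) i l \<noteq> 0}" by (rule finite_subset)
  qed
  moreover have "row_finite (zscale c A)" if "row_finite A" for c and A :: "'k zmat"
    by (rule row_finite_subset[OF that]) (simp add: zscale_def)
  ultimately show ?thesis
    by (auto simp: zmat.subspace_def row_finite_def)
qed

text \<open>Both products are sums over the same finite set of paths from \<open>i\<close> through the supports of
  the row \<open>i\<close> of \<open>A\<close> and of the rows of \<open>B\<close> that it meets.\<close>

lemma zmult_assoc: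
  assumes "row_finite A" "row_finite B"
  shows "zmult (zmult A B) C = zmult A (zmult B C)"
proof (intro ext)
  fix i j
  let ?F = "{k. A i k \<noteq> 0}"
  let ?G = "\<Union>k\<in>?F. {l. B k l \<noteq> 0}"
  have fin: "finite ?F" "finite ?G" using assms by (auto simp: row_finite_def)
  have AB: "zmult A B i l = (\<Sum>k\<in>?F. A i k * B k l)" for l
    by (rule zmult_row_finite[OF assms(1)])
  have BC: "zmult B C k j = (\<Sum>l\<in>?G. B k l * C l j)" if "k \<in> ?F" for k
    by (rule zmult_eq_sum) (use fin that in auto)
  have "zmult A B i l = 0" if "l \<notin> ?G" for l
    unfolding AB by (rule sum.neutral) (use that in auto)
  then have "zmult (zmult A B) C i j = (\<Sum>l\<in>?G. zmult A B i l * C l j)"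
    by (intro zmult_eq_sum) (use fin in auto)
  also have "\<dots> = (\<Sum>k\<in>?F. \<Sum>l\<in>?G. A i k * B k l * C l j)"
    unfolding AB sum_distrib_right by (rule sum.swap)
  also have "\<dots> = (\<Sum>k\<in>?F. A i k * zmult B C k j)"
    by (rule sum.cong) (simp_all add: BC sum_distrib_left mult.assoc)
  also have "\<dots> = zmult A (zmult B C) i j"
    by (rule zmult_row_finite[OF assms(1), symmetric])
  finally show "zmult (zmult A B) C i j = zmult A (zmult B C) i j" .
qed

lemma zmult_zero_left: "zmult 0 A = 0"
  by (simp add: zmult_def fun_eq_iff)

lemma zmult_zero_right: "zmult A 0 = 0"
  by (simp add: zmult_def fun_eq_iff)

lemma zmult_add_right:
  assumes "row_finite A"
  shows "zmult A (B + C) = zmult A B + zmult A C"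
  by (intro ext) (simp add: zmult_row_finite[OF assms] algebra_simps sum.distrib)

lemma zmult_add_left:
  assumes "row_finite A" "row_finite B"
  shows "zmult (A + B) C = zmult A C + zmult B C"
proof (intro ext)
  fix i j
  let ?F = "{k. A i k \<noteq> 0} \<union> {k. B i k \<noteq> 0}"
  have fin: "finite ?F" using assms by (auto simp: row_finite_def)
  have "zmult (A + B) C i j = (\<Sum>l\<in>?F. (A + B) i l * C l j)"
    by (rule zmult_eq_sum) (use fin in auto)
  moreover have "zmult A C i j = (\<Sum>l\<in>?F. A i l * C l j)"
    by (rule zmult_eq_sum) (use fin in auto)
  moreover have "zmult B C i j = (\<Sum>l\<in>?F. B i l * C l j)"
    by (rule zmult_eq_sum) (use fin in auto)
  ultimately show "zmult (A + B) C i j = (zmult A C + zmult B C) i j"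
    by (simp add: algebra_simps sum.distrib)
qed

lemma zmult_zscale_right:
  assumes "row_finite A"
  shows "zmult A (zscale c B) = zscale c (zmult A B)"
  by (intro ext)
    (simp add: zmult_row_finite[OF assms] zscale_def sum_distrib_left mult.left_commute)

lemma zmult_zscale_left:
  assumes "row_finite A"
  shows "zmult (zscale c A) B = zscale c (zmult A B)"
proof (intro ext)
  fix i j
  have "zmult (zscale c A) B i j = (\<Sum>l | A i l \<noteq> 0. zscale c A i l * B l j)"
    by (rule zmult_eq_sum) (use assms in \<open>auto simp: row_finite_def zscale_def\<close>)
  then show "zmult (zscale c A) B i j = zscale c (zmult A B) i j"
    by (simp add: zmult_row_finite[OF assms] zscale_def sum_distrib_left mult.assoc)
qed

section \<open>Shifts and diagonal idempotents\<close>

text \<open>The powers of the shift matrix and its transpose in one family, which is a homomorphism from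
  the additive group of the integers; \<open>T_mat\<close> itself is the value at \<open>- 1\<close>.\<close>

definition shift_mat :: "int \<Rightarrow> 'k::field zmat" where
  "shift_mat a = (\<lambda>i j. if j = i + a then 1 else 0)"

definition diag_ind :: "int set \<Rightarrow> 'k::field zmat" where
  "diag_ind A = (\<lambda>i j. if i = j \<and> i \<in> A then 1 else 0)"

lemma zone_eq_diag_ind: "zone = diag_ind UNIV"
  by (auto simp: zone_def diag_ind_def fun_eq_iff)

lemma D_mat_eq_diag_ind: "D_mat w x = diag_ind {i. w i = x}"
  by (auto simp: D_mat_def diag_ind_def fun_eq_iff)

lemma T_mat_eq_shift_mat: "T_mat = shift_mat (- 1)"
  by (auto simp: T_mat_def shift_mat_def fun_eq_iff)

lemma transpose_T_mat_eq_shift_mat: "ztranspose T_mat = shift_mat 1"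
  by (auto simp: T_mat_def ztranspose_def shift_mat_def fun_eq_iff)

lemma row_finite_diag_ind: "row_finite (diag_ind A)"
proof -
  have "{l. (diag_ind A i l :: 'a) \<noteq> 0} \<subseteq> {i}" for i by (auto simp: diag_ind_def)
  then show ?thesis unfolding row_finite_def by (meson finite.emptyI finite_insert finite_subset)
qed

lemma zmult_shift_mat_left: "zmult (shift_mat a) M i j = M (i + a) j"
  by (subst zmult_eq_sum[where F = "{i + a}"]) (auto simp: shift_mat_def)

lemma zmult_shift_mat_right: "zmult M (shift_mat a) i j = M i (j - a)"
  by (subst zmult_eq_sum[where F = "{j - a}"]) (auto simp: shift_mat_def)

lemma zmult_diag_ind_left: "zmult (diag_ind A) M i j = (if i \<in> A then M i j else 0)"
  by (subst zmult_eq_sum[where F = "{i}"]) (auto simp: diag_ind_def)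

lemma zmult_diag_ind_right: "zmult M (diag_ind A) i j = (if j \<in> A then M i j else 0)"
  by (subst zmult_eq_sum[where F = "{j}"]) (auto simp: diag_ind_def)

lemma zmult_zone_left: "zmult zone M = M"
  by (auto simp: zone_eq_diag_ind zmult_diag_ind_left fun_eq_iff)

lemma zmult_zone_right: "zmult M zone = M"
  by (auto simp: zone_eq_diag_ind zmult_diag_ind_right fun_eq_iff)

lemma zone_nonzero: "(zone :: 'k::field zmat) \<noteq> 0"
proof
  assume "zone = (0 :: 'k zmat)"
  then have "zone (0 :: int) 0 = (0 :: 'k)" by simp
  then show False by (simp add: zone_def)
qed

lemma zmult_diag_ind: "zmult (diag_ind A) (diag_ind B) = diag_ind (A \<inter> B)"
  unfolding fun_eq_iff zmult_diag_ind_left by (auto simp: diag_ind_def)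

lemma zmult_shift_mat: "zmult (shift_mat a) (shift_mat b) = shift_mat (a + b)"
  unfolding fun_eq_iff zmult_shift_mat_left by (auto simp: shift_mat_def)

lemma diag_ind_conj_shift_mat:
  "zmult (zmult (shift_mat a) (diag_ind A)) (shift_mat (- a)) = diag_ind {i. i + a \<in> A}"
  unfolding fun_eq_iff zmult_shift_mat_right zmult_shift_mat_left by (auto simp: diag_ind_def)

text \<open>Inclusion-exclusion. The correction term is what makes ideals closed under unions in every
  characteristic: a plain sum of idempotents would count overlaps, and the count may vanish.\<close>

lemma diag_ind_Un:
  "diag_ind (A \<union> B) = diag_ind A + (diag_ind B + zscale (- 1) (diag_ind (A \<inter> B)))"
  by (auto simp: diag_ind_def zscale_def fun_eq_iff)

section \<open>Local matrices\<close>

definition agree :: "(int \<Rightarrow> 'x) \<Rightarrow> nat \<Rightarrow> int \<Rightarrow> int \<Rightarrow> bool" where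
  "agree w r i j \<longleftrightarrow> (\<forall>t. \<bar>t\<bar> \<le> int r \<longrightarrow> w (i + t) = w (j + t))"

lemma agree_mono: "agree w s i j \<Longrightarrow> r \<le> s \<Longrightarrow> agree w r i j"
  by (auto simp: agree_def)

lemma agree_shift:
  assumes "agree w s i j" "\<bar>d\<bar> + int r \<le> int s"
  shows "agree w r (i + d) (j + d)"
  unfolding agree_def
proof (intro allI impI)
  fix t :: int assume "\<bar>t\<bar> \<le> int r"
  then have "\<bar>d + t\<bar> \<le> int s" using assms(2) by linarith
  then show "w (i + d + t) = w (j + d + t)"
    using assms(1) unfolding agree_def by (metis add.assoc)
qed

lemma subword_eq_iff:
  "subword w i n = subword w j n \<longleftrightarrow> (\<forall>m<n. w (i + int m) = w (j + int m))"
  by (auto simp: subword_def)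

lemma subword_eq_iff_agree:
  "subword w (i - int r) (Suc (2 * r)) = subword w (j - int r) (Suc (2 * r)) \<longleftrightarrow> agree w r i j"
proof
  assume L: "subword w (i - int r) (Suc (2 * r)) = subword w (j - int r) (Suc (2 * r))"
  show "agree w r i j" unfolding agree_def
  proof (intro allI impI)
    fix t :: int assume t: "\<bar>t\<bar> \<le> int r"
    then have "nat (t + int r) < Suc (2 * r)" by linarith
    then have "w (i - int r + int (nat (t + int r))) = w (j - int r + int (nat (t + int r)))"
      using L unfolding subword_eq_iff by blast
    moreover have "int (nat (t + int r)) = t + int r" using t by simp
    ultimately show "w (i + t) = w (j + t)" by (simp only: add_diff_eq diff_add_eq add_diff_cancel) simp
  qed
next
  assume R: "agree w r i j"
  show "subword w (i - int r) (Suc (2 * r)) = subword w (j - int r) (Suc (2 * r))"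
    unfolding subword_eq_iff
  proof (intro allI impI)
    fix m assume "m < Suc (2 * r)"
    then have "\<bar>int m - int r\<bar> \<le> int r" by linarith
    then have "w (i + (int m - int r)) = w (j + (int m - int r))"
      using R unfolding agree_def by blast
    then show "w (i - int r + int m) = w (j - int r + int m)" by (simp add: algebra_simps)
  qed
qed

text \<open>Bandwidth and window radius are bounded by the same number, so that a single parameter filters
  the algebra.\<close>

definition local_mats :: "(int \<Rightarrow> 'x) \<Rightarrow> nat \<Rightarrow> 'k::field zmat set" where
  "local_mats w r = {M. (\<forall>i j. int r < \<bar>i - j\<bar> \<longrightarrow> M i j = 0) \<and>
    (\<forall>i i' d. agree w r i i' \<longrightarrow> M i (i + d) = M i' (i' + d))}"

lemma local_mats_band: "M \<in> local_mats w r \<Longrightarrow> int r < \<bar>i - j\<bar> \<Longrightarrow> M i j = 0"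
  by (simp add: local_mats_def)

lemma local_mats_agree: "M \<in> local_mats w r \<Longrightarrow> agree w r i i' \<Longrightarrow> M i (i + d) = M i' (i' + d)"
  by (simp add: local_mats_def)

lemma local_mats_mono: "r \<le> s \<Longrightarrow> local_mats w r \<subseteq> local_mats w s"
  using agree_mono by (fastforce simp: local_mats_def)

lemma row_finite_local_mats:
  assumes "M \<in> local_mats w r"
  shows "row_finite M"
  unfolding row_finite_def
proof
  fix i
  have "{l. M i l \<noteq> 0} \<subseteq> {i - int r..i + int r}"
  proof
    fix l assume "l \<in> {l. M i l \<noteq> 0}"
    then have "\<bar>i - l\<bar> \<le> int r" using local_mats_band[OF assms, of i l] by force
    then show "l \<in> {i - int r..i + int r}" by auto
  qed
  then show "finite {l. M i l \<noteq> 0}" by (rule finite_subset) simp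
qed

lemma subspace_local_mats: "zmat.subspace (local_mats w r)"
  unfolding zmat.subspace_def local_mats_def zscale_def by auto

text \<open>In \<open>(M N) i (i + d)\<close> the sum runs over the steps \<open>e\<close> with \<open>\<bar>e\<bar> \<le> r\<close>, and the factor of \<open>N\<close> is read
  in the window of radius \<open>s\<close> around \<open>i + e\<close>, which lies in the window of radius \<open>r + s\<close>
  around \<open>i\<close>.\<close>

lemma zmult_local_mats:
  assumes M: "M \<in> local_mats w r" and N: "N \<in> local_mats w s"
  shows "zmult M N \<in> local_mats w (r + s)"
proof -
  have expand: "zmult M N i (i + d) = (\<Sum>e\<in>{- int r..int r}. M i (i + e) * N (i + e) (i + d))"
    for i d
  proof -
    have "zmult M N i (i + d) = (\<Sum>l\<in>(\<lambda>e. i + e) ` {- int r..int r}. M i l * N l (i + d))"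
    proof (rule zmult_eq_sum)
      fix l assume "l \<notin> (\<lambda>e. i + e) ` {- int r..int r}"
      then have "l - i \<notin> {- int r..int r}" by (metis add.commute diff_add_cancel image_eqI)
      then have "int r < \<bar>i - l\<bar>" by auto
      then show "M i l * N l (i + d) = 0" by (simp add: local_mats_band[OF M])
    qed simp
    also have "\<dots> = (\<Sum>e\<in>{- int r..int r}. M i (i + e) * N (i + e) (i + d))"
      by (subst sum.reindex) auto
    finally show ?thesis .
  qed
  have "zmult M N i j = 0" if "int (r + s) < \<bar>i - j\<bar>" for i j
  proof -
    have "(\<Sum>e\<in>{- int r..int r}. M i (i + e) * N (i + e) (i + (j - i))) = 0"
    proof (rule sum.neutral, rule ballI)
      fix e assume "e \<in> {- int r..int r}"
      then have "int s < \<bar>(i + e) - j\<bar>" using that by auto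
      then show "M i (i + e) * N (i + e) (i + (j - i)) = 0" by (simp add: local_mats_band[OF N])
    qed
    then show ?thesis using expand[of i "j - i"] by simp
  qed
  moreover have "zmult M N i (i + d) = zmult M N i' (i' + d)" if a: "agree w (r + s) i i'" for i i' d
    unfolding expand
  proof (rule sum.cong)
    fix e assume e: "e \<in> {- int r..int r}"
    have "M i (i + e) = M i' (i' + e)"
      by (rule local_mats_agree[OF M agree_mono[OF a]]) simp
    moreover have "agree w s (i + e) (i' + e)"
      by (rule agree_shift[OF a]) (use e in auto)
    from local_mats_agree[OF N this, of "d - e"]
    have "N (i + e) (i + d) = N (i' + e) (i' + d)" by (simp add: algebra_simps)
    ultimately show "M i (i + e) * N (i + e) (i + d) = M i' (i' + e) * N (i' + e) (i' + d)"
      by simp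
  qed simp
  ultimately show ?thesis by (simp add: local_mats_def)
qed

lemma shift_mat_local: "shift_mat a \<in> local_mats w (nat \<bar>a\<bar>)"
  by (auto simp: local_mats_def shift_mat_def)

lemma D_mat_local: "D_mat w x \<in> local_mats w 0"
  by (auto simp: local_mats_def D_mat_def agree_def)

lemma zone_local: "zone \<in> local_mats w 0"
  by (auto simp: local_mats_def zone_def)

lemma word_algebra_local:
  assumes "M \<in> word_algebra X w"
  shows "\<exists>r. M \<in> local_mats w r"
  using assms unfolding word_algebra_def
proof (induction rule: generated_algebra.induct)
  case (gen A)
  then consider x where "A = D_mat w x" | "A = shift_mat (- 1)" | "A = shift_mat 1"
    using T_mat_eq_shift_mat transpose_T_mat_eq_shift_mat by auto
  then show ?case
    by cases (use D_mat_local shift_mat_local in metis)+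
next
  case one
  then show ?case using zone_local by blast
next
  case (scale A c)
  then show ?case using zmat.subspace_scale[OF subspace_local_mats] by blast
next
  case (add A B)
  then obtain r s where "A \<in> local_mats w r" "B \<in> local_mats w s" by blast
  then have "A \<in> local_mats w (max r s)" "B \<in> local_mats w (max r s)"
    using local_mats_mono[of r "max r s" w] local_mats_mono[of s "max r s" w] by auto
  then show ?case using zmat.subspace_add[OF subspace_local_mats] by blast
next
  case (mult A B)
  then show ?case using zmult_local_mats by blast
qed

lemma word_algebra_row_finite: "M \<in> word_algebra X w \<Longrightarrow> row_finite M"
  using word_algebra_local row_finite_local_mats by blast

section \<open>Simplicity\<close>

lemma shift_mat_in_word_algebra: "(shift_mat a :: 'k::field zmat) \<in> word_algebra X w"
proof -
  have nat: "(shift_mat (s * int n) :: 'k zmat) \<in> word_algebra X w"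
    if "(shift_mat s :: 'k zmat) \<in> word_algebra X w" for s n
  proof (induction n)
    case 0
    have "shift_mat (s * int 0) = (zone :: 'k zmat)" by (auto simp: shift_mat_def zone_def fun_eq_iff)
    then show ?case unfolding word_algebra_def by (simp only: generated_algebra.one)
  next
    case (Suc n)
    then have "zmult (shift_mat s) (shift_mat (s * int n)) \<in> (word_algebra X w :: 'k zmat set)"
      using that unfolding word_algebra_def by (intro generated_algebra.mult)
    then show ?case by (simp add: zmult_shift_mat algebra_simps)
  qed
  have "(shift_mat 1 :: 'k zmat) \<in> word_algebra X w"
    "(shift_mat (- 1) :: 'k zmat) \<in> word_algebra X w"
    unfolding word_algebra_def T_mat_eq_shift_mat[symmetric] transpose_T_mat_eq_shift_mat[symmetric]
    by (auto intro: generated_algebra.gen)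
  from nat[OF this(1), of "nat a"] nat[OF this(2), of "nat (- a)"] show ?thesis
    by (cases "a \<ge> 0") auto
qed

text \<open>A window condition is a finite conjunction of conditions on single letters, and the idempotent
  of a condition on the letter at distance \<open>t\<close> is a conjugate of some \<open>D_mat w x\<close> by a shift.\<close>

lemma cylinder_in_word_algebra:
  assumes "range w \<subseteq> X"
  shows "(diag_ind {i. agree w r i i0} :: 'k::field zmat) \<in> word_algebra X w"
proof -
  let ?A = "word_algebra X w :: 'k zmat set"
  have mult: "zmult A B \<in> ?A" if "A \<in> ?A" "B \<in> ?A" for A B
    using that unfolding word_algebra_def by (rule generated_algebra.mult)
  have letter: "diag_ind {i. w (i + t) = w (i0 + t)} \<in> ?A" for t
  proof -
    have "diag_ind {i. w i = w (i0 + t)} \<in> ?A"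
      unfolding word_algebra_def D_mat_eq_diag_ind[symmetric]
      using assms by (intro generated_algebra.gen) auto
    then have "zmult (zmult (shift_mat t) (diag_ind {i. w i = w (i0 + t)})) (shift_mat (- t))
        \<in> ?A"
      by (intro mult shift_mat_in_word_algebra)
    then show ?thesis by (simp add: diag_ind_conj_shift_mat)
  qed
  have "diag_ind (\<Inter>t\<in>F. {i. w (i + t) = w (i0 + t)}) \<in> ?A" if "finite F" for F
    using that
  proof (induction F)
    case empty
    then show ?case by (simp add: word_algebra_def zone_eq_diag_ind[symmetric] generated_algebra.one)
  next
    case (insert t F)
    then have "zmult (diag_ind {i. w (i + t) = w (i0 + t)})
        (diag_ind (\<Inter>t\<in>F. {i. w (i + t) = w (i0 + t)})) \<in> ?A"
      by (intro mult letter)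
    then show ?case by (simp add: zmult_diag_ind)
  qed
  from this[of "{- int r..int r}"]
  have "diag_ind (\<Inter>t\<in>{- int r..int r}. {i. w (i + t) = w (i0 + t)}) \<in> ?A" by simp
  moreover have "(\<Inter>t\<in>{- int r..int r}. {i. w (i + t) = w (i0 + t)}) = {i. agree w r i i0}"
    by (auto simp: agree_def abs_le_iff)
  ultimately show ?thesis by simp
qed

lemma minimal_word_agree:
  assumes "minimal_word w"
  shows "\<exists>R::nat. \<forall>i. \<exists>j. \<bar>i - j\<bar> \<le> int R \<and> agree w k j n"
proof -
  obtain R where R: "R > 0"
    "\<forall>i. \<exists>j. \<bar>i - j\<bar> \<le> R \<and> subword w j (Suc (2 * k)) = subword w (n - int k) (Suc (2 * k))"
    using assms unfolding minimal_word_def by meson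
  have "\<exists>j. \<bar>i - j\<bar> \<le> int (nat R) \<and> agree w k j n" for i
  proof -
    obtain j where j: "\<bar>(i - int k) - j\<bar> \<le> R"
      "subword w j (Suc (2 * k)) = subword w (n - int k) (Suc (2 * k))" using R by blast
    then have "agree w k (j + int k) n" using subword_eq_iff_agree[of w "j + int k" k n] by simp
    then show ?thesis using j(1) R(1) by (intro exI[of _ "j + int k"]) auto
  qed
  then show ?thesis by blast
qed

text \<open>If windows of every radius reappear somewhere at distance \<open>d\<close>, then \<open>w\<close> has arbitrarily long
  stretches with period \<open>d\<close>. By minimality a copy of any given short window occurs in such a
  stretch, so \<open>w\<close> itself has period \<open>d\<close>.\<close>

lemma minimal_nonperiodic_separation:
  assumes min: "minimal_word w" and np: "nonperiodic_word w" and "d \<noteq> 0"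
  shows "\<exists>K. \<forall>i. \<not> agree w K i (i + d)"
proof (rule ccontr)
  assume "\<not> ?thesis"
  then have per: "\<exists>i. agree w K i (i + d)" for K by blast
  have "w (n + d) = w n" for n
  proof -
    obtain R where R: "\<forall>i. \<exists>j. \<bar>i - j\<bar> \<le> int R \<and> agree w (nat \<bar>d\<bar>) j n"
      using minimal_word_agree[OF min] by blast
    \<comment> \<open>The stretch of period \<open>d\<close> around \<open>i\<close> has radius \<open>R\<close>, so it contains the centre \<open>j\<close> of a copy.\<close>
    obtain i where i: "agree w R i (i + d)" using per by blast
    obtain j where j: "\<bar>i - j\<bar> \<le> int R" "agree w (nat \<bar>d\<bar>) j n" using R by blast
    have "\<bar>j - i\<bar> \<le> int R" using j(1) by linarith
    then have "w (i + (j - i)) = w (i + d + (j - i))" using i unfolding agree_def by blast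
    then have "w j = w (j + d)" by (simp add: algebra_simps)
    moreover have "w (j + 0) = w (n + 0)" "w (j + d) = w (n + d)"
      using j(2) unfolding agree_def by (auto simp del: add_0_right)
    ultimately show ?thesis by simp
  qed
  with np \<open>d \<noteq> 0\<close> show False unfolding nonperiodic_word_def by blast
qed

lemma minimal_nonperiodic_uniform_separation:
  assumes "minimal_word w" "nonperiodic_word w"
  shows "\<exists>K\<ge>r. \<forall>i j. agree w K i j \<and> \<bar>i - j\<bar> \<le> int r \<longrightarrow> i = j"
proof -
  have "\<forall>d. \<exists>K. d \<noteq> 0 \<longrightarrow> (\<forall>i. \<not> agree w K i (i + d))"
    using minimal_nonperiodic_separation[OF assms] by blast
  then obtain f where f: "\<And>d i. d \<noteq> 0 \<Longrightarrow> \<not> agree w (f d) i (i + d)" by metis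
  let ?D = "{- int r..int r}"
  define K where "K = Max (insert r (f ` ?D))"
  have "i = j" if "agree w K i j" "\<bar>i - j\<bar> \<le> int r" for i j
  proof (rule ccontr)
    assume "i \<noteq> j"
    have "j - i \<in> ?D" using that(2) by auto
    then have "f (j - i) \<le> K" unfolding K_def by (intro Max_ge) auto
    with that(1) have "agree w (f (j - i)) i (i + (j - i))" using agree_mono by fastforce
    with f[of "j - i" i] \<open>i \<noteq> j\<close> show False by simp
  qed
  moreover have "r \<le> K" unfolding K_def by (intro Max_ge) auto
  ultimately show ?thesis by blast
qed

lemma ring_zmat_ring:
  fixes B :: "'k::field zmat set"
  assumes G: "generated_algebra G = B" and fin: "\<And>A. A \<in> B \<Longrightarrow> row_finite A"
  shows "ring (zmat_ring B)"
proof (rule ringI)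
  have zero: "0 = zscale 0 (zone :: 'k zmat)" by (auto simp: zscale_def fun_eq_iff)
  show "abelian_group (zmat_ring B)"
  proof (rule abelian_groupI)
    fix A assume "A \<in> carrier (zmat_ring B)"
    then have "A \<in> B" by (simp add: zmat_ring_def)
    then have "zscale (- 1) A \<in> B" using G generated_algebra.scale by blast
    then have "- A \<in> carrier (zmat_ring B)" by (simp add: zmat_ring_def)
    then show "\<exists>y\<in>carrier (zmat_ring B). y \<oplus>\<^bsub>zmat_ring B\<^esub> A = \<zero>\<^bsub>zmat_ring B\<^esub>"
      by (intro bexI[of _ "- A"]) (simp_all add: zmat_ring_def)
  next
    have "zscale 0 zone \<in> B" using G generated_algebra.one generated_algebra.scale by blast
    then show "\<zero>\<^bsub>zmat_ring B\<^esub> \<in> carrier (zmat_ring B)"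
      unfolding zero[symmetric] by (simp add: zmat_ring_def)
  qed (use G in \<open>auto simp: zmat_ring_def add_ac intro: generated_algebra.add\<close>)
  show "Group.monoid (zmat_ring B)"
    by (rule monoidI)
      (use G in \<open>auto simp: zmat_ring_def zmult_zone_left zmult_zone_right zmult_assoc fin
        intro: generated_algebra.mult generated_algebra.one\<close>)
qed (auto simp: zmat_ring_def zmult_add_left zmult_add_right fin)

text \<open>A corner of an element of the ideal by a fine enough cylinder idempotent is a nonzero multiple
  of that idempotent, and finitely many shifts of the cylinder cover the integers.\<close>

lemma word_algebra_ideal_trivial:
  fixes I :: "'k::field zmat set"
  assumes X: "range w \<subseteq> X" and min: "minimal_word w" and np: "nonperiodic_word w"
    and I: "ideal I (zmat_ring (word_algebra X w))" and "I \<noteq> {0}"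
  shows "I = word_algebra X w"
proof -
  let ?A = "word_algebra X w :: 'k zmat set"
  have sub: "I \<subseteq> ?A"
    using additive_subgroup.a_subset[OF ideal.axioms(1)[OF I]] by (simp add: zmat_ring_def)
  have add: "M + N \<in> I" if "M \<in> I" "N \<in> I" for M N
    using additive_subgroup.a_closed[OF ideal.axioms(1)[OF I] that] by (simp add: zmat_ring_def)
  have zero: "0 \<in> I"
    using additive_subgroup.zero_closed[OF ideal.axioms(1)[OF I]] by (simp add: zmat_ring_def)
  have left: "zmult M N \<in> I" and right: "zmult N M \<in> I" if "M \<in> ?A" "N \<in> I" for M N
    using ideal.I_l_closed[OF I, of N M] ideal.I_r_closed[OF I, of N M] that
    by (simp_all add: zmat_ring_def)
  have one: "zone \<in> ?A" by (simp add: word_algebra_def generated_algebra.one)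
  have scale: "zscale c M \<in> I" if "M \<in> I" for c M
  proof -
    have "zscale c zone \<in> ?A"
      using one unfolding word_algebra_def by (rule generated_algebra.scale)
    from left[OF this that] show ?thesis
      by (simp add: zmult_zscale_left zone_eq_diag_ind row_finite_diag_ind)
        (simp add: zone_eq_diag_ind[symmetric] zmult_zone_left)
  qed
  note shift = shift_mat_in_word_algebra[where X = X and w = w]
  obtain M where M: "M \<in> I" "M \<noteq> 0" using \<open>I \<noteq> {0}\<close> zero by blast
  then obtain i0 j0 where c: "M i0 j0 \<noteq> 0" by (auto simp: fun_eq_iff)
  \<comment> \<open>Shifting the columns moves the nonzero entry to the diagonal.\<close>
  define N where "N = zmult M (shift_mat (i0 - j0))"
  have N: "N \<in> I" unfolding N_def by (rule right[OF shift M(1)])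
  have N0: "N i0 i0 = M i0 j0" by (simp add: N_def zmult_shift_mat_right)
  obtain r where r: "N \<in> local_mats w r" using N sub word_algebra_local by blast
  obtain K where K: "r \<le> K" "\<And>i j. agree w K i j \<Longrightarrow> \<bar>i - j\<bar> \<le> int r \<Longrightarrow> i = j"
    using minimal_nonperiodic_uniform_separation[OF min np] by blast
  \<comment> \<open>Distinct points of \<open>U\<close> are further apart than the bandwidth of \<open>N\<close>, and \<open>r \<le> K\<close> makes the
    diagonal of \<open>N\<close> constant on \<open>U\<close>.\<close>
  define U where "U = {i. agree w K i i0}"
  have EinA: "diag_ind U \<in> ?A" unfolding U_def by (rule cylinder_in_word_algebra[OF X])
  have corner: "zmult (zmult (diag_ind U) N) (diag_ind U) = zscale (M i0 j0) (diag_ind U)"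
  proof (intro ext)
    fix i j
    have "N i j = 0" if "i \<in> U" "j \<in> U" "i \<noteq> j"
    proof -
      have "agree w K i j" using that unfolding U_def agree_def by auto
      then have "int r < \<bar>i - j\<bar>" using K(2) that(3) by force
      then show ?thesis by (rule local_mats_band[OF r])
    qed
    moreover have "N i i = M i0 j0" if "i \<in> U"
    proof -
      have "agree w r i i0" using that K(1) agree_mono unfolding U_def by blast
      from local_mats_agree[OF r this, of 0] show ?thesis using N0 by simp
    qed
    ultimately show "zmult (zmult (diag_ind U) N) (diag_ind U) i j
        = zscale (M i0 j0) (diag_ind U) i j"
      unfolding zmult_diag_ind_right zmult_diag_ind_left by (auto simp: diag_ind_def zscale_def)
  qed
  have "zscale (M i0 j0) (diag_ind U) \<in> I"
    unfolding corner[symmetric] by (rule right[OF EinA left[OF EinA N]])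
  from scale[OF this, of "inverse (M i0 j0)"] have EinI: "diag_ind U \<in> I"
    using c by (simp add: zscale_def mult.assoc[symmetric])
  have trans: "diag_ind {i. i + t \<in> U} \<in> I" for t
    using right[OF shift left[OF shift EinI], of t "- t"] by (simp add: diag_ind_conj_shift_mat)
  have union: "diag_ind (\<Union>t\<in>F. {i. i + t \<in> U}) \<in> I" if "finite F" for F
    using that
  proof (induction F)
    case empty
    have "diag_ind {} = (0 :: 'k zmat)" by (auto simp: diag_ind_def fun_eq_iff)
    then show ?case unfolding UN_empty using zero by (simp only:)
  next
    case (insert t F)
    let ?V = "\<Union>t\<in>F. {i. i + t \<in> U}"
    have "zmult (diag_ind {i. i + t \<in> U}) (diag_ind ?V) \<in> I"
      using trans[of t] insert sub by (intro left) auto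
    then have "diag_ind ({i. i + t \<in> U} \<inter> ?V) \<in> I" by (simp add: zmult_diag_ind)
    then show ?case
      unfolding UN_insert diag_ind_Un using trans[of t] insert.IH by (blast intro: add scale)
  qed
  obtain R where R: "\<forall>i. \<exists>j. \<bar>i - j\<bar> \<le> int R \<and> agree w K j i0"
    using minimal_word_agree[OF min] by blast
  have "i \<in> (\<Union>t\<in>{- int R..int R}. {i. i + t \<in> U})" for i
  proof -
    obtain j where "\<bar>i - j\<bar> \<le> int R" "j \<in> U" using R unfolding U_def by blast
    then have "j - i \<in> {- int R..int R}" "i + (j - i) \<in> U" by auto
    then show ?thesis by blast
  qed
  then have "(\<Union>t\<in>{- int R..int R}. {i. i + t \<in> U}) = UNIV" by blast
  then have "zone \<in> I" using union[of "{- int R..int R}"] by (simp add: zone_eq_diag_ind)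
  then have "M \<in> I" if "M \<in> ?A" for M using left[OF that] by (metis zmult_zone_right)
  with sub show ?thesis by blast
qed

lemma word_algebra_simple:
  assumes "range w \<subseteq> X" "minimal_word w" "nonperiodic_word w"
  shows "simple_ring (zmat_ring (word_algebra X w :: 'k::field zmat set))"
proof -
  let ?A = "word_algebra X w :: 'k zmat set"
  have "ring (zmat_ring ?A)"
    by (rule ring_zmat_ring[OF word_algebra_def[symmetric]]) (rule word_algebra_row_finite)
  moreover have "zone \<in> ?A" by (simp add: word_algebra_def generated_algebra.one)
  then have "?A \<noteq> {0}" using zone_nonzero by blast
  ultimately show ?thesis
    using word_algebra_ideal_trivial[OF assms] by (auto simp: simple_ring_def zmat_ring_def)
qed

section \<open>Subword complexity\<close>

lemma length_subword: "length (subword w i n) = n"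
  by (simp add: subword_def)

lemma finite_subwords:
  assumes "finite X" "range w \<subseteq> X"
  shows "finite (range (\<lambda>i. subword w i n))"
proof (rule finite_subset)
  show "range (\<lambda>i. subword w i n) \<subseteq> {xs. set xs \<subseteq> X \<and> length xs = n}"
    using assms(2) by (auto simp: subword_def image_subset_iff)
qed (rule finite_lists_length_eq[OF assms(1)])

lemma complexity_mono:
  assumes "finite X" "range w \<subseteq> X" "m \<le> n"
  shows "complexity w m \<le> complexity w n"
proof -
  have "take m (subword w i n) = subword w i m" for i
    using assms(3) by (simp add: subword_def take_map min_def)
  then have "range (\<lambda>i. subword w i m) = take m ` range (\<lambda>i. subword w i n)"
    by (simp add: image_image)
  then show ?thesis
    unfolding complexity_def using card_image_le[OF finite_subwords[OF assms(1,2)]] by simp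
qed

section \<open>Cells: bases of spaces of local matrices\<close>

text \<open>The indicator of the occurrences of the word \<open>u\<close>, placed on the diagonal with offset \<open>d\<close>. The
  parameter \<open>a\<close> is the position of the occurrence relative to the row: centred windows use
  \<open>a = - r\<close>, while products of generators yield \<open>a = 0\<close>.\<close>

definition cell :: "(int \<Rightarrow> 'x) \<Rightarrow> int \<Rightarrow> 'x list \<Rightarrow> int \<Rightarrow> 'k::field zmat" where
  "cell w a u d = (\<lambda>i j. if subword w (i + a) (length u) = u \<and> j = i + d then 1 else 0)"

text \<open>The coefficient of the cell of \<open>(u, d)\<close> is the common value of \<open>M\<close> on the diagonal \<open>d\<close> at all
  occurrences of \<open>u\<close>, read off at one chosen occurrence.\<close>

lemma local_mats_in_span_cells:
  fixes M :: "'k::field zmat"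
  assumes "finite X" "range w \<subseteq> X" "M \<in> local_mats w r"
  shows "M \<in> zmat.span ((\<lambda>(u, d). cell w (- int r) u d) `
    (range (\<lambda>i. subword w i (Suc (2 * r))) \<times> {- int r..int r}))"
    (is "M \<in> zmat.span (?c ` (?U \<times> ?D))")
proof -
  have finU: "finite ?U" by (rule finite_subwords[OF assms(1,2)])
  \<comment> \<open>\<open>p u\<close> is the centre of an occurrence of the window \<open>u\<close>.\<close>
  define p where "p u = (SOME i. subword w (i - int r) (Suc (2 * r)) = u)" for u
  have p: "agree w r (p (subword w (i - int r) (Suc (2 * r)))) i" for i
  proof -
    have "subword w (p (subword w (i - int r) (Suc (2 * r))) - int r) (Suc (2 * r))
        = subword w (i - int r) (Suc (2 * r))"
      unfolding p_def by (rule someI_ex) blast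
    then show ?thesis unfolding subword_eq_iff_agree .
  qed
  have app: "(sum f S) i j = (\<Sum>x\<in>S. f x i j)" for f :: "'a list \<times> int \<Rightarrow> 'k zmat" and S i j
    by (induction S rule: infinite_finite_induct) auto
  have "M = (\<Sum>x\<in>?U \<times> ?D. zscale (M (p (fst x)) (p (fst x) + snd x)) (?c x))"
  proof (intro ext)
    fix i j
    let ?u = "subword w (i - int r) (Suc (2 * r))"
    let ?g = "\<lambda>x. M (p (fst x)) (p (fst x) + snd x) * ?c x i j"
    have z: "?g x = 0" if "x \<in> ?U \<times> ?D" "x \<noteq> (?u, j - i)" for x
      using that by (auto simp: cell_def length_subword split: if_splits)
    have "(\<Sum>x\<in>?U \<times> ?D. ?g x) = M i j"
    proof (cases "j - i \<in> ?D")
      case True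
      then have mem: "(?u, j - i) \<in> ?U \<times> ?D" by auto
      have "(\<Sum>x\<in>?U \<times> ?D. ?g x) = (\<Sum>x\<in>{(?u, j - i)}. ?g x)"
        by (rule sum.mono_neutral_right) (use finU mem z in auto)
      also have "\<dots> = M (p ?u) (p ?u + (j - i))"
        by (simp add: cell_def length_subword)
      also have "\<dots> = M i j"
        using local_mats_agree[OF assms(3) p, of i "j - i"] by simp
      finally show ?thesis .
    next
      case False
      then have "M i j = 0" by (intro local_mats_band[OF assms(3)]) auto
      moreover have "(\<Sum>x\<in>?U \<times> ?D. ?g x) = 0"
      proof (rule sum.neutral, rule ballI)
        fix x assume x: "x \<in> ?U \<times> ?D"
        then have "x \<noteq> (?u, j - i)" using False by auto
        with x show "?g x = 0" by (rule z)
      qed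
      ultimately show ?thesis by simp
    qed
    then show "M i j = (\<Sum>x\<in>?U \<times> ?D. zscale (M (p (fst x)) (p (fst x) + snd x)) (?c x)) i j"
      by (simp add: app zscale_def)
  qed
  also have "\<dots> \<in> zmat.span (?c ` (?U \<times> ?D))"
    by (intro zmat.span_sum zmat.span_scale zmat.span_base) auto
  finally show ?thesis .
qed

lemma dim_le_if_local:
  fixes V :: "'k::field zmat set"
  assumes "finite X" "range w \<subseteq> X" "V \<subseteq> local_mats w r"
  shows "zmat.dim V \<le> Suc (2 * r) * complexity w (Suc (2 * r))"
    and "\<exists>B. finite B \<and> V \<subseteq> zmat.span B"
proof -
  let ?P = "range (\<lambda>i. subword w i (Suc (2 * r))) \<times> {- int r..int r}"
  let ?B = "(\<lambda>(u, d). cell w (- int r) u d :: 'k zmat) ` ?P"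
  have fin: "finite ?P" using finite_subwords[OF assms(1,2)] by simp
  have sub: "V \<subseteq> zmat.span ?B" using local_mats_in_span_cells[OF assms(1,2)] assms(3) by blast
  then show "\<exists>B. finite B \<and> V \<subseteq> zmat.span B" using fin by blast
  have "zmat.dim V \<le> card ?B" by (rule zmat.dim_le_card[OF sub]) (use fin in auto)
  also have "\<dots> \<le> card ?P" by (rule card_image_le[OF fin])
  also have "\<dots> = Suc (2 * r) * complexity w (Suc (2 * r))"
  proof -
    have "card {- int r..int r} = Suc (2 * r)" by simp
    then show ?thesis by (simp only: card_cartesian_product complexity_def mult.commute)
  qed
  finally show "zmat.dim V \<le> Suc (2 * r) * complexity w (Suc (2 * r))" .
qed

text \<open>In an infinite-dimensional subspace \<open>zmat.dim\<close> is 0, so an independent set bounds it from below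
  only for a subspace of finite dimension, which the finite spanning set \<open>B\<close> guarantees.\<close>

lemma independent_card_le_dim_of_finite_span:
  fixes V :: "'k::field zmat set"
  assumes "finite B" "V \<subseteq> zmat.span B" "zmat.independent C" "C \<subseteq> V"
  shows "card C \<le> zmat.dim V"
proof -
  obtain E where E: "E \<subseteq> V" "zmat.independent E" "V \<subseteq> zmat.span E" "card E = zmat.dim V"
    by (rule zmat.basis_exists)
  have "finite E"
    using zmat.independent_span_bound[OF assms(1) E(2)] E(1) assms(2) by blast
  then show ?thesis
    using zmat.independent_span_bound[OF _ assms(3), of E] E(3,4) assms(4) by fastforce
qed

text \<open>Words of equal length give cells with pairwise disjoint supports, and each support is nonempty
  because the words are taken from \<open>w\<close>.\<close>

lemma cells_independent:
  fixes w :: "int \<Rightarrow> 'x"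
  assumes "finite D" "finite (range (\<lambda>i. subword w i n))"
  defines "c \<equiv> (\<lambda>(u, d). cell w 0 u d :: 'k::field zmat)"
    and "P \<equiv> range (\<lambda>i. subword w i n) \<times> D"
  shows "zmat.independent (c ` P)" "card (c ` P) = complexity w n * card D"
proof -
  have delta: "c y i (i + d) = (if y = (subword w i n, d) then 1 else 0)" if "y \<in> P" for y i d
    using that by (auto simp: c_def P_def cell_def length_subword split: if_splits)
  have inj: "inj_on c P"
  proof
    fix x y assume x: "x \<in> P" and y: "y \<in> P" and eq: "c x = c y"
    obtain i d where xe: "x = (subword w i n, d)" using x by (auto simp: P_def)
    have "c x i (i + d) = 1" using delta[OF x] xe by simp
    with eq have "c y i (i + d) \<noteq> 0" by simp
    then show "x = y" using delta[OF y] xe by (metis (full_types))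
  qed
  have fin: "finite P" using assms by (simp add: P_def)
  show "card (c ` P) = complexity w n * card D"
    by (simp add: card_image[OF inj]) (simp add: P_def card_cartesian_product complexity_def)
  have app: "(sum f S) i j = (\<Sum>x\<in>S. f x i j)" for f :: "'k zmat \<Rightarrow> 'k zmat" and S i j
    by (induction S rule: infinite_finite_induct) auto
  show "zmat.independent (c ` P)"
  proof (rule zmat.independent_if_scalars_zero)
    fix f A assume z: "(\<Sum>A\<in>c ` P. zscale (f A) A) = 0" and "A \<in> c ` P"
    then obtain x where x: "x \<in> P" "A = c x" by blast
    then obtain i d where xe: "x = (subword w i n, d)" by (auto simp: P_def)
    have "0 = (\<Sum>A\<in>c ` P. f A * A i (i + d))"
      using z by (metis (no_types, lifting) app sum.cong zero_fun_apply zscale_def)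
    also have "\<dots> = (\<Sum>y\<in>P. f (c y) * c y i (i + d))" by (simp add: sum.reindex[OF inj])
    also have "\<dots> = (\<Sum>y\<in>P. if y = x then f (c x) else 0)"
      by (rule sum.cong) (auto simp: delta xe)
    also have "\<dots> = f A" using fin x by simp
    finally show "f A = 0" by simp
  qed (use fin in simp)
qed

text \<open>Reading one letter and moving one step to the right; iterated, this writes a cell as a product
  of two generators for each letter.\<close>

lemma cell_Cons:
  "cell w 0 (x # u) (int (length (x # u)))
    = zmult (D_mat w x) (zmult (shift_mat 1) (cell w 0 u (int (length u))))"
proof -
  have "subword w i (Suc n) = w i # subword w (i + 1) n" for i n
    unfolding subword_def by (simp add: upt_conv_Cons map_Suc_upt[symmetric] algebra_simps del: upt_Suc)
  then show ?thesis
    unfolding fun_eq_iff D_mat_eq_diag_ind zmult_diag_ind_left zmult_shift_mat_left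
    by (auto simp: cell_def)
qed

lemma cell_Nil: "cell w 0 [] 0 = zone"
  by (auto simp: cell_def zone_def subword_def fun_eq_iff)

lemma zmult_cell_shift_mat: "zmult (cell w a u d) (shift_mat b) = cell w a u (d + b)"
  unfolding fun_eq_iff zmult_shift_mat_right by (auto simp: cell_def)

section \<open>The filtration by powers of a generating space\<close>

text \<open>The assumptions make the spaces \<open>product_span V n\<close> an increasing multiplicative filtration
  of the algebra generated by \<open>V\<close>.\<close>

locale unital_row_finite =
  fixes V :: "'k::field zmat set"
  assumes one: "zone \<in> V"
    and row_finite: "A \<in> V \<Longrightarrow> row_finite A"
begin

lemma row_finite_foldr: "set as \<subseteq> V \<Longrightarrow> row_finite (foldr zmult as zone)"
  by (induction as) (auto simp: zone_eq_diag_ind row_finite_diag_ind intro: row_finite_zmult row_finite)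

lemma product_span_subspace: "zmat.subspace (product_span V n)"
  unfolding product_span_def by (rule zmat.subspace_span)

lemma foldr_append:
  assumes "set as \<subseteq> V"
  shows "zmult (foldr zmult as zone) M = foldr zmult as M"
  using assms
  by (induction as) (auto simp: zmult_zone_left zmult_assoc row_finite row_finite_foldr)

lemma product_span_mult:
  assumes "A \<in> product_span V m" "B \<in> product_span V n"
  shows "zmult A B \<in> product_span V (m + n)"
proof -
  let ?G = "\<lambda>n. {foldr zmult as zone |as. length as = n \<and> set as \<subseteq> V}"
  have gens: "zmult P Q \<in> product_span V (m + n)" if PQ: "P \<in> ?G m" "Q \<in> ?G n" for P Q
  proof -
    obtain as bs where a: "length as = m" "set as \<subseteq> V" "P = foldr zmult as zone"
      and b: "length bs = n" "set bs \<subseteq> V" "Q = foldr zmult bs zone" using PQ by blast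
    have "zmult P Q = foldr zmult (as @ bs) zone" by (simp add: a b foldr_append)
    moreover have "foldr zmult (as @ bs) zone \<in> ?G (m + n)"
      using a(1,2) b(1,2) by (intro CollectI exI[of _ "as @ bs"]) simp
    ultimately have "zmult P Q \<in> ?G (m + n)" by (simp only:)
    then show ?thesis unfolding product_span_def by (rule zmat.span_base)
  qed
  have step: "zmult P B \<in> product_span V (m + n)" if P: "P \<in> ?G m" for P
  proof -
    have "row_finite P" using P row_finite_foldr by blast
    then have "zmat.subspace {B. zmult P B \<in> product_span V (m + n)}"
      using product_span_subspace[of "m + n"] zmult_zero_right[of P]
      by (simp add: zmat.subspace_def zmult_add_right zmult_zscale_right)
    then have "product_span V n \<subseteq> {B. zmult P B \<in> product_span V (m + n)}"
      unfolding product_span_def[of V n] using gens[OF P] by (intro zmat.span_minimal) auto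
    with assms(2) show ?thesis by blast
  qed
  have "zmat.subspace {A. row_finite A \<and> zmult A B \<in> product_span V (m + n)}"
    using product_span_subspace[of "m + n"] subspace_row_finite zmult_zero_left[of B]
    unfolding zmat.subspace_def by (auto simp: zmult_add_left zmult_zscale_left)
  then have "product_span V m \<subseteq> {A. row_finite A \<and> zmult A B \<in> product_span V (m + n)}"
    unfolding product_span_def[of V m] using step row_finite_foldr
    by (intro zmat.span_minimal) auto
  with assms(1) show ?thesis by blast
qed

lemma product_span_1: "A \<in> V \<Longrightarrow> A \<in> product_span V 1"
  unfolding product_span_def
  by (intro zmat.span_base CollectI exI[of _ "[A]"]) (simp add: zmult_zone_right)

lemma product_span_one: "zone \<in> product_span V 0"
  unfolding product_span_def by (intro zmat.span_base CollectI exI[of _ "[]"]) simp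

lemma product_span_mono:
  assumes "m \<le> n"
  shows "product_span V m \<subseteq> product_span V n"
  using assms
proof (induction n rule: dec_induct)
  case (step n)
  have "A \<in> product_span V (Suc n)" if "A \<in> product_span V n" for A
    using product_span_mult[OF that product_span_1[OF one]] by (simp add: zmult_zone_right)
  with step show ?case by blast
qed simp

lemma generated_algebra_product_span:
  assumes "A \<in> generated_algebra V"
  shows "\<exists>m. A \<in> product_span V m"
  using assms
proof (induction rule: generated_algebra.induct)
  case (gen A)
  then show ?case using product_span_1 by blast
next
  case one
  then show ?case using product_span_one by blast
next
  case (scale A c)
  then show ?case using zmat.subspace_scale[OF product_span_subspace] by blast
next
  case (add A B)
  then obtain m n where "A \<in> product_span V m" "B \<in> product_span V n" by blast
  then have "A \<in> product_span V (max m n)" "B \<in> product_span V (max m n)"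
    using product_span_mono[of m "max m n"] product_span_mono[of n "max m n"] by auto
  then show ?case using zmat.subspace_add[OF product_span_subspace] by blast
next
  case (mult A B)
  then obtain m n where "A \<in> product_span V m" "B \<in> product_span V n" by blast
  then show ?case using product_span_mult by blast
qed

text \<open>This is how an arbitrary generating set is compared with the standard one: the standard
  generators lie in a fixed power of the span of the arbitrary one.\<close>

lemma finite_in_product_span:
  assumes "finite F" "F \<subseteq> generated_algebra V"
  shows "\<exists>m>0. F \<subseteq> product_span V m"
  using assms
proof (induction F)
  case (insert A F)
  then obtain m where "m > 0" "F \<subseteq> product_span V m" by blast
  moreover obtain k where "A \<in> product_span V k"
    using generated_algebra_product_span insert.prems by blast
  ultimately have "insert A F \<subseteq> product_span V (max m k)" "max m k > 0"
    using product_span_mono[of m "max m k"] product_span_mono[of k "max m k"] by auto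
  then show ?case by blast
qed auto

lemma product_span_local:
  assumes "V \<subseteq> local_mats w r"
  shows "product_span V n \<subseteq> local_mats w (r * n)"
proof -
  have "foldr zmult as zone \<in> local_mats w (r * length as)" if "set as \<subseteq> V" for as
    using that
  proof (induction as)
    case Nil
    then show ?case by (simp add: zone_local)
  next
    case (Cons A as)
    then have "zmult A (foldr zmult as zone) \<in> local_mats w (r + r * length as)"
      using assms by (intro zmult_local_mats) auto
    then show ?case by (simp add: algebra_simps)
  qed
  then show ?thesis
    unfolding product_span_def by (intro zmat.span_minimal subspace_local_mats) auto
qed

text \<open>The word costs two generators for each letter and ends on the diagonal \<open>length u\<close>; at most one
  further generator for each letter, a power of \<open>T_mat\<close>, moves it back to the diagonal \<open>d\<close>.\<close>

lemma cell_in_product_span: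
  assumes D: "D_mat w ` set u \<subseteq> product_span V m"
    and T: "T_mat \<in> product_span V m" "ztranspose T_mat \<in> product_span V m"
    and d: "d \<le> length u"
  shows "cell w 0 u (int d) \<in> product_span V (3 * m * length u)"
proof -
  have full: "cell w 0 u (int (length u)) \<in> product_span V (2 * m * length u)"
    using D
  proof (induction u)
    case Nil
    then show ?case by (simp add: cell_Nil product_span_one)
  next
    case (Cons x u)
    then have "zmult (D_mat w x) (zmult (shift_mat 1) (cell w 0 u (int (length u))))
        \<in> product_span V (m + (m + 2 * m * length u))"
      using T(2) unfolding transpose_T_mat_eq_shift_mat by (intro product_span_mult) auto
    then show ?case
      unfolding cell_Cons by (simp add: algebra_simps)
  qed
  have "cell w 0 u (int (length u) - int e) \<in> product_span V (2 * m * length u + m * e)" for e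
  proof (induction e)
    case 0
    then show ?case using full by simp
  next
    case (Suc e)
    from product_span_mult[OF this T(1)] show ?case
      unfolding T_mat_eq_shift_mat zmult_cell_shift_mat by (simp add: algebra_simps)
  qed
  from this[of "length u - d"] have
    "cell w 0 u (int d) \<in> product_span V (2 * m * length u + m * (length u - d))"
    using d by (simp add: of_nat_diff)
  moreover have "2 * m * length u + m * (length u - d) \<le> 3 * m * length u"
  proof -
    have "m * (length u - d) \<le> m * length u" by (rule mult_le_mono2) simp
    then show ?thesis by linarith
  qed
  ultimately show ?thesis using product_span_mono by blast
qed

end

section \<open>Growth\<close>

lemma generated_algebra_mono: "G \<subseteq> H \<Longrightarrow> generated_algebra G \<subseteq> generated_algebra H"
proof
  fix A assume "G \<subseteq> H" "A \<in> generated_algebra G"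
  from this(2,1) show "A \<in> generated_algebra H"
    by (induction rule: generated_algebra.induct) (auto intro: generated_algebra.intros)
qed

text \<open>Both growth estimates with integer constants: \<open>r\<close> is a locality radius of the generating set,
  and \<open>m\<close> is a power of its span that contains the standard generators.\<close>

lemma word_algebra_growth:
  fixes S :: "'k::field zmat set"
  assumes X: "finite X" "range w \<subseteq> X"
    and S: "finite S" "zone \<in> S" "generated_algebra S = word_algebra X w"
  shows "\<exists>r m. 0 < r \<and> 0 < m \<and> (\<forall>n. growth S n \<le> Suc (2 * (r * n)) * complexity w (Suc (2 * (r * n))))
    \<and> (\<forall>n k. 3 * m * k \<le> n \<longrightarrow> k * complexity w k \<le> growth S n) \<and> (\<forall>n. 1 \<le> growth S n)"
proof -
  let ?V = "zmat.span S"
  have SA: "S \<subseteq> word_algebra X w" using S(3) generated_algebra.gen by blast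
  have "\<exists>r>0. S \<subseteq> local_mats w r"
    using S(1) SA
  proof (induction S)
    case (insert A F)
    then obtain r where "r > 0" "F \<subseteq> local_mats w r" by blast
    moreover obtain s where "A \<in> local_mats w s"
      using word_algebra_local insert.prems by blast
    ultimately have "insert A F \<subseteq> local_mats w (max r s)" "max r s > 0"
      using local_mats_mono[of r "max r s" w] local_mats_mono[of s "max r s" w] by auto
    then show ?case by blast
  qed auto
  then obtain r where r: "r > 0" "S \<subseteq> local_mats w r" by blast
  have VL: "?V \<subseteq> local_mats w r" by (rule zmat.span_minimal[OF r(2) subspace_local_mats])
  interpret unital_row_finite ?V
    using VL row_finite_local_mats S(2)
    by unfold_locales (auto intro: zmat.span_base zmat.subspace_span)
  have "word_algebra X w \<subseteq> generated_algebra ?V"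
    unfolding S(3)[symmetric] by (rule generated_algebra_mono[OF zmat.span_superset])
  moreover have "D_mat w ` X \<union> {T_mat, ztranspose T_mat} \<subseteq> (word_algebra X w :: 'k zmat set)"
    unfolding word_algebra_def by (auto intro: generated_algebra.gen)
  ultimately obtain m where m: "m > 0" "D_mat w ` X \<union> {T_mat, ztranspose T_mat} \<subseteq> product_span ?V m"
    using finite_in_product_span[of "D_mat w ` X \<union> {T_mat, ztranspose T_mat}"] X(1) by auto
  note loc = product_span_local[OF VL]
  have ge: "card C \<le> growth S n" if "zmat.independent C" "C \<subseteq> product_span ?V n" for C n
  proof -
    obtain B where "finite B" "product_span ?V n \<subseteq> zmat.span B"
      using dim_le_if_local(2)[OF X loc] by blast
    from independent_card_le_dim_of_finite_span[OF this that] show ?thesis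
      by (simp add: growth_def)
  qed
  have "k * complexity w k \<le> growth S n" if "3 * m * k \<le> n" for n k
  proof -
    let ?C = "(\<lambda>(u, d). cell w 0 u d :: 'k zmat) ` (range (\<lambda>i. subword w i k) \<times> int ` {..<k})"
    have "?C \<subseteq> product_span ?V n"
    proof
      fix A assume "A \<in> ?C"
      then obtain i d where A: "A = cell w 0 (subword w i k) (int d)" "d < k" by auto
      have "set (subword w i k) \<subseteq> X" using X(2) by (auto simp: subword_def image_subset_iff)
      with m(2) have "D_mat w ` set (subword w i k) \<subseteq> product_span ?V m" by blast
      then have "A \<in> product_span ?V (3 * m * k)"
        using cell_in_product_span[of w "subword w i k" m d] m(2) A
        by (simp add: length_subword)
      then show "A \<in> product_span ?V n" using product_span_mono[OF that] by blast
    qed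
    from ge[OF _ this] show ?thesis
      using cells_independent[OF _ finite_subwords[OF X], of "int ` {..<k}" k, where 'k = 'k]
      by (simp add: card_image mult.commute)
  qed
  moreover have "1 \<le> growth S n" for n
  proof -
    have "zone \<in> product_span ?V n" using product_span_mono[of 0 n] product_span_one by blast
    then show ?thesis using ge[of "{zone}" n] zone_nonzero by simp
  qed
  moreover have "growth S n \<le> Suc (2 * (r * n)) * complexity w (Suc (2 * (r * n)))" for n
    unfolding growth_def by (rule dim_le_if_local(1)[OF X loc])
  ultimately show ?thesis using r(1) m(1) by blast
qed

theorem theorem1p2:
  fixes X :: "'x set" and w :: "int \<Rightarrow> 'x"
  assumes "finite X" and "range w \<subseteq> X"
    and "minimal_word w" and "nonperiodic_word w"
  shows "simple_ring (zmat_ring (word_algebra X w :: 'k::field zmat set)) \<and>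
    (\<forall>S :: 'k zmat set.
      finite S \<and> zone \<in> S \<and> generated_algebra S = word_algebra X w \<longrightarrow>
      (\<exists>C::real. C > 1 \<and> (\<forall>n::nat. n \<ge> 1 \<longrightarrow>
        inverse C * real n * real (complexity_real w (inverse C * real n)) \<le> real (growth S n) \<and>
        real (growth S n) \<le> C * real n * real (complexity_real w (C * real n)))))"
proof (intro conjI allI impI)
  show "simple_ring (zmat_ring (word_algebra X w :: 'k zmat set))"
    by (rule word_algebra_simple[OF assms(2-4)])
next
  fix S :: "'k zmat set"
  assume S: "finite S \<and> zone \<in> S \<and> generated_algebra S = word_algebra X w"
  obtain r m where rm: "0 < r" "0 < m"
    and upper: "\<And>n. growth S n \<le> Suc (2 * (r * n)) * complexity w (Suc (2 * (r * n)))"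
    and lower: "\<And>n k. 3 * m * k \<le> n \<Longrightarrow> k * complexity w k \<le> growth S n"
    and pos: "\<And>n. 1 \<le> growth S n"
    using word_algebra_growth[of X w S] assms(1,2) S by metis
  note mono = complexity_mono[OF assms(1,2)]
  \<comment> \<open>The upper bound needs \<open>2 r n + 1 \<le> c n\<close>. For the lower bound let \<open>k\<close> be the quotient of \<open>n\<close> by
    \<open>3 m\<close>: if \<open>k > 0\<close> then \<open>n < 3 m (k + 1) \<le> 6 m k\<close>, hence \<open>n / c \<le> k\<close>; if \<open>k = 0\<close> then \<open>n / c < 1\<close>
    and the claim reduces to \<open>growth S n \<ge> 1\<close>.\<close>
  define c where "c = 3 * r + 6 * m"
  define C where "C = real c"
  have C1: "C > 1" using rm by (simp add: C_def c_def)
  have "real (growth S n) \<le> C * real n * real (complexity_real w (C * real n))" if "n \<ge> 1" for n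
  proof -
    have "1 \<le> r * n" using rm that by simp
    then have "Suc (2 * (r * n)) \<le> 3 * r * n" by linarith
    also have "\<dots> \<le> c * n" unfolding c_def by simp
    finally have le: "Suc (2 * (r * n)) \<le> c * n" .
    have "growth S n \<le> (c * n) * complexity w (c * n)"
      using upper[of n] mult_le_mono[OF le mono[OF le]] by linarith
    then have "real (growth S n) \<le> real ((c * n) * complexity w (c * n))"
      by (simp only: of_nat_le_iff)
    moreover have Cn: "C * real n = real (c * n)" by (simp add: C_def)
    have "complexity_real w (C * real n) = complexity w (c * n)"
      unfolding complexity_real_def Cn by (simp only: floor_of_nat nat_int)
    ultimately show ?thesis unfolding Cn by simp
  qed
  moreover have "inverse C * real n * real (complexity_real w (inverse C * real n))
      \<le> real (growth S n)" if "n \<ge> 1" for n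
  proof -
    define k where "k = n div (3 * m)"
    have n: "3 * m * k \<le> n" "n < 3 * m * (k + 1)"
      using mult_div_mod_eq[of "3 * m" n] mod_less_divisor[of "3 * m" n] rm
      unfolding k_def distrib_left by linarith+
    define t where "t = inverse C * real n"
    have t0: "t \<ge> 0" using C1 by (simp add: t_def)
    show ?thesis
    proof (cases "k = 0")
      case True
      then have "n < c" using n(2) by (simp add: c_def)
      then have "t < 1" using C1 by (simp add: t_def C_def field_simps)
      then have "\<lfloor>t\<rfloor> = 0" using t0 by linarith
      then have "complexity_real w t = 1"
        by (simp add: complexity_real_def complexity_def subword_def)
      with \<open>t < 1\<close> pos[of n] show ?thesis unfolding t_def[symmetric] by simp
    next
      case False
      then have "3 * m * (k + 1) \<le> 6 * m * k" by (simp add: algebra_simps)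
      also have "\<dots> \<le> c * k" by (simp add: c_def)
      finally have "real n \<le> real (c * k)" using n(2) by linarith
      then have tk: "t \<le> real k" using C1 by (simp add: t_def C_def field_simps)
      then have "nat \<lfloor>t\<rfloor> \<le> k" by linarith
      then have "complexity_real w t \<le> complexity w k"
        unfolding complexity_real_def by (rule mono)
      then have "t * real (complexity_real w t) \<le> real k * real (complexity w k)"
        using tk t0 by (intro mult_mono) auto
      also have "\<dots> = real (k * complexity w k)" by simp
      also have "\<dots> \<le> real (growth S n)" using lower[OF n(1)] by (simp only: of_nat_le_iff)
      finally show ?thesis unfolding t_def .
    qed
  qed
  ultimately show "\<exists>C::real. C > 1 \<and> (\<forall>n::nat. n \<ge> 1 \<longrightarrow>
        inverse C * real n * real (complexity_real w (inverse C * real n)) \<le> real (growth S n) \<and>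
        real (growth S n) \<le> C * real n * real (complexity_real w (C * real n)))"
    using C1 by blast
qed

end
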